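(* Let $V$ be a real separable Hilbert space and let $a,b,m$ be symmetric bilinear forms on $V$ such that $a$ is continuous and $V$-coercive, $b$ is weakly continuous, and $m$ is weakly continuous with $m(u,u)>0$ for all nonzero $u\in V$. If $e_1,e_2$ are eigenvectors of $(a,b,m)$ corresponding to eigenpoints $(\lambda_1,\mu_1)$ and $(\lambda_2,\mu_2)$ in $\sigma(a,b,m)$, respectively, then $$(\lambda_2-\lambda_1)\,b(e_1,e_2)+(\mu_2-\mu_1)\,m(e_1,e_2)=0.$$
   Context: "$a$ is continuous and $V$-coercive" means there are constants $0<\kappa_1\le\kappa_2<\infty$ with $\kappa_1\|u\|^2\le a(u,u)\le\kappa_2\|u\|^2$ for all $u\in V$. A symmetric bilinear form $b$ on $V$ is weakly continuous if $u_j\rightharpoonup u$ and $v_j\rightharpoonup v$ weakly in $V$ imply $b(u_j,v_j)\to b(u,v)$. A pair $(\lambda,\mu)\in\mathbb{R}^2$ is an eigenpoint of $(a,b,m)$ if there is a nonzero $u\in V$ (an eigenvector corresponding to $(\lambda,\mu)$) with $a(u,v)=\lambda\,b(u,v)+\mu\,m(u,v)$ for all $v\in V$; $\sigma(a,b,m)\subset\mathbb{R}^2$ is the set of all eigenpoints. *)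

theory Defs
  imports "HOL-Analysis.Analysis"
begin

definition symmetric_bilinear_form :: "('v::real_vector \<Rightarrow> 'v \<Rightarrow> real) \<Rightarrow> bool" where
  "symmetric_bilinear_form b \<longleftrightarrow> bilinear b \<and> (\<forall>u v. b u v = b v u)"

(* The upper bound on the diagonal expresses continuity of a: for a symmetric bilinear form
   it is equivalent, given the lower bound, to boundedness of a in both arguments. *)
definition continuous_coercive :: "('v::real_normed_vector \<Rightarrow> 'v \<Rightarrow> real) \<Rightarrow> bool" where
  "continuous_coercive a \<longleftrightarrow>
     (\<exists>\<kappa>1 \<kappa>2. 0 < \<kappa>1 \<and> \<kappa>1 \<le> \<kappa>2 \<and>
        (\<forall>u. \<kappa>1 * (norm u)\<^sup>2 \<le> a u u \<and> a u u \<le> \<kappa>2 * (norm u)\<^sup>2))"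

(* Weak convergence of sequences, tested against the continuous dual of the space. *)
definition weakly_converges :: "(nat \<Rightarrow> 'v::real_normed_vector) \<Rightarrow> 'v \<Rightarrow> bool" where
  "weakly_converges u l \<longleftrightarrow>
     (\<forall>f :: 'v \<Rightarrow> real. bounded_linear f \<longrightarrow> (\<lambda>j. f (u j)) \<longlonglongrightarrow> f l)"

definition weakly_continuous :: "('v::real_normed_vector \<Rightarrow> 'v \<Rightarrow> real) \<Rightarrow> bool" where
  "weakly_continuous b \<longleftrightarrow>
     (\<forall>us vs u v. weakly_converges us u \<longrightarrow> weakly_converges vs v \<longrightarrow>
        (\<lambda>j. b (us j) (vs j)) \<longlonglongrightarrow> b u v)"

(* The pair p is (lambda, mu): the first component weights b, the second weights m. *)
definition eigenvector ::
  "('v::real_vector \<Rightarrow> 'v \<Rightarrow> real) \<Rightarrow> ('v \<Rightarrow> 'v \<Rightarrow> real) \<Rightarrow> ('v \<Rightarrow> 'v \<Rightarrow> real) \<Rightarrow> real \<times> real \<Rightarrow> 'v \<Rightarrow> bool" where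
  "eigenvector a b m p u \<longleftrightarrow>
     u \<noteq> 0 \<and> (\<forall>v. a u v = fst p * b u v + snd p * m u v)"

definition eigenpoints ::
  "('v::real_vector \<Rightarrow> 'v \<Rightarrow> real) \<Rightarrow> ('v \<Rightarrow> 'v \<Rightarrow> real) \<Rightarrow> ('v \<Rightarrow> 'v \<Rightarrow> real) \<Rightarrow> (real \<times> real) set" where
  "eigenpoints a b m = {p. \<exists>u. eigenvector a b m p u}"

end

theory Submission
  imports Defs
begin

theorem theorem5p1:
  fixes a b m :: "'v::{real_inner, complete_space} \<Rightarrow> 'v \<Rightarrow> real"
    and e1 e2 :: 'v
    and lam1 mu1 lam2 mu2 :: real
  assumes "separable_space (euclidean :: 'v topology)"
    and "symmetric_bilinear_form a" and "symmetric_bilinear_form b" and "symmetric_bilinear_form m"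
    and "continuous_coercive a"
    and "weakly_continuous b"
    and "weakly_continuous m" and "\<forall>u. u \<noteq> 0 \<longrightarrow> m u u > 0"
    and "(lam1, mu1) \<in> eigenpoints a b m" and "(lam2, mu2) \<in> eigenpoints a b m"
    and "eigenvector a b m (lam1, mu1) e1" and "eigenvector a b m (lam2, mu2) e2"
  shows "(lam2 - lam1) * b e1 e2 + (mu2 - mu1) * m e1 e2 = 0"
proof -
  \<comment> \<open>The value \<open>a e1 e2\<close> is computed twice, testing the eigenvalue equation of \<open>e1\<close> against
     \<open>e2\<close> and that of \<open>e2\<close> against \<open>e1\<close>; symmetry of the three forms makes the results comparable.\<close>
  have "a e1 e2 = lam1 * b e1 e2 + mu1 * m e1 e2"
    using assms(11) by (simp add: eigenvector_def)
  moreover have "a e2 e1 = lam2 * b e2 e1 + mu2 * m e2 e1"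
    using assms(12) by (simp add: eigenvector_def)
  moreover have "a e2 e1 = a e1 e2" "b e2 e1 = b e1 e2" "m e2 e1 = m e1 e2"
    using assms(2-4) by (simp_all add: symmetric_bilinear_form_def)
  ultimately show ?thesis
    by (simp add: algebra_simps)
qed

end
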